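(* Let $H$ be an $n$-vertex graph, and let $G$ be a trigraph obtained by subdividing each edge of $H$ at least $2\lceil \log_2 n\rceil-1$ times and then turning red an arbitrary subset of the edges of the resulting graph, subject to the conditions that every vertex of $G$ has red degree at most $4$ and no vertex of red degree $4$ has a neighbour joined to it by a black edge. Then $tww(G)\leqslant 4$.
   Context: A trigraph $G$ consists of a vertex set $V(G)$ and two disjoint sets of unordered pairs of distinct vertices: black edges $E(G)$ and red edges $R(G)$; a graph is a trigraph with no red edge. The red degree of a vertex is the number of red edges incident to it. Contracting two distinct vertices $u,v$ of a trigraph replaces them by a single new vertex $w$ such that, for every other vertex $z$, $wz$ is a black edge if $uz$ and $vz$ are both black edges, $wz$ is a non-edge if $uz$ and $vz$ are both non-edges, and $wz$ is a red edge otherwise; the rest of the trigraph is unchanged. A contraction sequence from an $n$-vertex trigraph $G$ is a sequence $G=G_n,\dots,G_1$ in which each $G_{j}$ is obtained from $G_{j+1}$ by one contraction. A $d$-sequence is a contraction sequence in which every trigraph has maximum red degree at most $d$. The twin-width $tww(G)$ is the least $d$ such that $G$ admits a $d$-sequence. *)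

theory Defs
  imports Complex_Main
begin

record 'v trigraph =
  verts :: "'v set"
  blacks :: "'v set set"
  reds :: "'v set set"

definition wf_trigraph :: "'v trigraph \<Rightarrow> bool" where
  "wf_trigraph G \<longleftrightarrow> finite (verts G)
     \<and> blacks G \<subseteq> {{x, y} | x y. x \<in> verts G \<and> y \<in> verts G \<and> x \<noteq> y}
     \<and> reds G \<subseteq> {{x, y} | x y. x \<in> verts G \<and> y \<in> verts G \<and> x \<noteq> y}
     \<and> blacks G \<inter> reds G = {}"

definition red_degree :: "'v trigraph \<Rightarrow> 'v \<Rightarrow> nat" where
  "red_degree G x = card {e \<in> reds G. x \<in> e}"

definition contract :: "'v trigraph \<Rightarrow> 'v \<Rightarrow> 'v \<Rightarrow> 'v \<Rightarrow> 'v trigraph" where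
  "contract G u v w =
    \<lparr> verts = (verts G - {u, v}) \<union> {w},
      blacks = {e \<in> blacks G. u \<notin> e \<and> v \<notin> e}
        \<union> {{w, z} | z. z \<in> verts G - {u, v} \<and> {u, z} \<in> blacks G \<and> {v, z} \<in> blacks G},
      reds = {e \<in> reds G. u \<notin> e \<and> v \<notin> e}
        \<union> {{w, z} | z. z \<in> verts G - {u, v}
              \<and> \<not> ({u, z} \<in> blacks G \<and> {v, z} \<in> blacks G)
              \<and> ({u, z} \<in> blacks G \<union> reds G \<or> {v, z} \<in> blacks G \<union> reds G)} \<rparr>"

definition is_contraction :: "'v trigraph \<Rightarrow> 'v trigraph \<Rightarrow> bool" where
  "is_contraction G G' \<longleftrightarrow> (\<exists>u v w. u \<in> verts G \<and> v \<in> verts G \<and> u \<noteq> v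
      \<and> w \<notin> verts G - {u, v} \<and> G' = contract G u v w)"

definition contraction_seq :: "'v trigraph \<Rightarrow> 'v trigraph list \<Rightarrow> bool" where
  "contraction_seq G gs \<longleftrightarrow> length gs = card (verts G)
     \<and> (gs \<noteq> [] \<longrightarrow> hd gs = G)
     \<and> (\<forall>i. Suc i < length gs \<longrightarrow> is_contraction (gs ! i) (gs ! Suc i))"

definition d_sequence :: "nat \<Rightarrow> 'v trigraph \<Rightarrow> 'v trigraph list \<Rightarrow> bool" where
  "d_sequence d G gs \<longleftrightarrow> contraction_seq G gs
     \<and> (\<forall>g \<in> set gs. \<forall>x \<in> verts g. red_degree g x \<le> d)"

definition tww :: "'v trigraph \<Rightarrow> nat" where
  "tww G = (LEAST d. \<exists>gs. d_sequence d G gs)"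

definition simple_graph :: "'a set \<Rightarrow> 'a set set \<Rightarrow> bool" where
  "simple_graph V E \<longleftrightarrow> finite V \<and> E \<subseteq> {{x, y} | x y. x \<in> V \<and> y \<in> V \<and> x \<noteq> y}"

text \<open>Subdivision of a graph on a linearly ordered vertex type: the edge {x,y} with x < y
  receives s x y new vertices Inr (x,y,1), ..., Inr (x,y,s x y), forming the path
  Inl x - Inr (x,y,1) - ... - Inr (x,y,s x y) - Inl y.\<close>
definition sub_vertex :: "'a \<Rightarrow> 'a \<Rightarrow> nat \<Rightarrow> nat \<Rightarrow> 'a + ('a \<times> 'a \<times> nat)" where
  "sub_vertex x y s i = (if i = 0 then Inl x else if i = Suc s then Inl y else Inr (x, y, i))"

definition subdiv_verts :: "('a::linorder) set \<Rightarrow> 'a set set \<Rightarrow> ('a \<Rightarrow> 'a \<Rightarrow> nat)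
    \<Rightarrow> ('a + ('a \<times> 'a \<times> nat)) set" where
  "subdiv_verts V E s = Inl ` V
     \<union> {Inr (x, y, i) | x y i. x < y \<and> {x, y} \<in> E \<and> 1 \<le> i \<and> i \<le> s x y}"

definition subdiv_edges :: "('a::linorder) set set \<Rightarrow> ('a \<Rightarrow> 'a \<Rightarrow> nat)
    \<Rightarrow> ('a + ('a \<times> 'a \<times> nat)) set set" where
  "subdiv_edges E s = {{sub_vertex x y (s x y) i, sub_vertex x y (s x y) (Suc i)} | x y i.
       x < y \<and> {x, y} \<in> E \<and> i \<le> s x y}"

end

theory Submission
  imports Defs
begin

text \<open>
  Put k = \<lceil>log 2 n\<rceil> and let the vertices of H be leaves of a full binary tree of height k. Every
  subdivided edge xy has room for the walk from leaf x up to the root and down to leaf y. The paths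
  are folded onto these walks one after the other, each from x to y. At any time a tree node is
  adjacent to at most three tree nodes and to the next vertex of the path being folded, while a
  vertex of H gains at most one red edge (to its parent), which replaces a former one if it had
  red degree 4. Finally the tree, of maximum degree 3, is collapsed bottom-up.

  Intermediate trigraphs are quotients of G by maps f from the vertices of G to names (tree nodes
  and unprocessed subdivision vertices). Folding a vertex onto a tree node that has no preimage yet
  is a mere renaming, so the tree need not be added to G.
\<close>

subsection \<open>Quotient trigraphs and contraction sequences\<close>

text \<open>A contraction makes an edge black iff both old ones are black, and absent iff both are
  absent. Iterated, this depends only on the partition: two fibres of \<open>f\<close> are joined
  iff some cross pair is, and by a black edge iff all cross pairs are black.\<close>

definition quot_adj :: "'v trigraph \<Rightarrow> ('v \<Rightarrow> 'p) \<Rightarrow> 'p \<Rightarrow> 'p \<Rightarrow> bool" where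
  "quot_adj G f p q \<longleftrightarrow> (\<exists>x\<in>verts G. \<exists>y\<in>verts G. f x = p \<and> f y = q \<and> {x, y} \<in> blacks G \<union> reds G)"

definition quot_black :: "'v trigraph \<Rightarrow> ('v \<Rightarrow> 'p) \<Rightarrow> 'p \<Rightarrow> 'p \<Rightarrow> bool" where
  "quot_black G f p q \<longleftrightarrow> (\<forall>x\<in>verts G. \<forall>y\<in>verts G. f x = p \<longrightarrow> f y = q \<longrightarrow> {x, y} \<in> blacks G)"

definition quot_red_nbrs :: "'v trigraph \<Rightarrow> ('v \<Rightarrow> 'p) \<Rightarrow> 'p \<Rightarrow> 'p set" where
  "quot_red_nbrs G f p = {q. q \<noteq> p \<and> quot_adj G f p q \<and> \<not> quot_black G f p q}"

text \<open>The trigraph g is the quotient of G by f, each class being represented by one of its members: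
  contraction sequences have to stay inside the vertex type of G.\<close>
definition represents :: "'v trigraph \<Rightarrow> 'v trigraph \<Rightarrow> ('v \<Rightarrow> 'p) \<Rightarrow> bool" where
  "represents g G f \<longleftrightarrow> wf_trigraph g \<and> verts g \<subseteq> verts G \<and> bij_betw f (verts g) (f ` verts G)
     \<and> (\<forall>a\<in>verts g. \<forall>b\<in>verts g. a \<noteq> b \<longrightarrow>
          ({a, b} \<in> blacks g \<longleftrightarrow> quot_black G f (f a) (f b)) \<and>
          ({a, b} \<in> reds g \<longleftrightarrow> quot_adj G f (f a) (f b) \<and> \<not> quot_black G f (f a) (f b)))"

definition merge :: "'p \<Rightarrow> 'p \<Rightarrow> ('v \<Rightarrow> 'p) \<Rightarrow> 'v \<Rightarrow> 'p" where
  "merge c d f = (\<lambda>x. if f x = c then d else f x)"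

lemma quot_adj_commute: "quot_adj G f p q = quot_adj G f q p"
proof -
  have "quot_adj G f q p" if adj: "quot_adj G f p q" for p q
  proof -
    obtain x y where xy: "x \<in> verts G" "y \<in> verts G" "f x = p" "f y = q" "{x, y} \<in> blacks G \<union> reds G"
      using adj unfolding quot_adj_def by blast
    have "{y, x} \<in> blacks G \<union> reds G" using xy(5) by (simp add: insert_commute)
    then show ?thesis unfolding quot_adj_def using xy by blast
  qed
  then show ?thesis by blast
qed

lemma quot_black_commute: "quot_black G f p q = quot_black G f q p"
proof -
  have "quot_black G f q p" if "quot_black G f p q" for p q
    unfolding quot_black_def
  proof (intro ballI impI)
    fix x y assume "x \<in> verts G" "y \<in> verts G" "f x = q" "f y = p"
    then have "{y, x} \<in> blacks G" using that unfolding quot_black_def by blast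
    then show "{x, y} \<in> blacks G" by (simp add: insert_commute)
  qed
  then show ?thesis by blast
qed

lemma finite_quot_red_nbrs: "finite (verts G) \<Longrightarrow> finite (quot_red_nbrs G f p)"
  by (rule finite_subset[of _ "f ` verts G"]) (auto simp: quot_red_nbrs_def quot_adj_def)

lemma wf_trigraph_edgeD:
  assumes "wf_trigraph G" "{x, y} \<in> blacks G \<union> reds G"
  shows "x \<in> verts G" "y \<in> verts G" "x \<noteq> y"
proof -
  have "{x, y} \<in> {{x, y} | x y. x \<in> verts G \<and> y \<in> verts G \<and> x \<noteq> y}"
    using assms unfolding wf_trigraph_def by blast
  then show "x \<in> verts G" "y \<in> verts G" "x \<noteq> y"
    by (auto simp: doubleton_eq_iff)
qed

lemma wf_trigraph_edgeE:
  assumes "wf_trigraph G" "e \<in> blacks G \<union> reds G" "a \<in> e"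
  obtains b where "e = {a, b}" "a \<in> verts G" "b \<in> verts G" "a \<noteq> b"
proof -
  have "e \<in> {{x, y} | x y. x \<in> verts G \<and> y \<in> verts G \<and> x \<noteq> y}"
    using assms(1,2) unfolding wf_trigraph_def by blast
  then obtain x y where "e = {x, y}" "x \<in> verts G" "y \<in> verts G" "x \<noteq> y"
    by blast
  with assms(3) have "(a = x \<and> e = {a, y}) \<or> (a = y \<and> e = {a, x})"
    by auto
  then show thesis
    using that \<open>x \<in> verts G\<close> \<open>y \<in> verts G\<close> \<open>x \<noteq> y\<close> by metis
qed

text \<open>A red edge at \<open>a\<close> is determined by the class of its other end, since
  \<open>f\<close> is injective on the representatives.\<close>

lemma red_degree_represents_le:
  assumes rep: "represents g G f" and fin: "finite (verts G)" and a: "a \<in> verts g"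
  shows "red_degree g a \<le> card (quot_red_nbrs G f (f a))"
proof -
  have inj: "inj_on f (verts g)" and wf: "wf_trigraph g"
    using rep by (auto simp: represents_def bij_betw_def)
  have "{e \<in> reds g. a \<in> e} \<subseteq> (\<lambda>q. {a, inv_into (verts g) f q}) ` quot_red_nbrs G f (f a)"
  proof
    fix e assume e: "e \<in> {e \<in> reds g. a \<in> e}"
    obtain b where b: "e = {a, b}" "b \<in> verts g" "a \<noteq> b"
      using wf_trigraph_edgeE[OF wf, of e a] e by blast
    have "f b \<noteq> f a"
      using inj a b by (auto dest: inj_onD)
    moreover have "quot_adj G f (f a) (f b) \<and> \<not> quot_black G f (f a) (f b)"
      using rep a b e by (auto simp: represents_def)
    ultimately have "f b \<in> quot_red_nbrs G f (f a)"
      by (simp add: quot_red_nbrs_def)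
    moreover have "inv_into (verts g) f (f b) = b"
      using inj b by simp
    ultimately show "e \<in> (\<lambda>q. {a, inv_into (verts g) f q}) ` quot_red_nbrs G f (f a)"
      using b by force
  qed
  from surj_card_le[OF finite_quot_red_nbrs[OF fin] this] show ?thesis
    unfolding red_degree_def .
qed

text \<open>Renaming the classes injectively keeps the partition. This covers merges that identify
  no two classes.\<close>

lemma represents_relabel:
  assumes rep: "represents g G f" and h: "inj_on h (f ` verts G)"
  shows "represents g G (\<lambda>x. h (f x))"
proof -
  have sub: "verts g \<subseteq> verts G" and bij: "bij_betw f (verts g) (f ` verts G)"
    using rep by (auto simp: represents_def)
  have eq: "h (f x) = h (f y) \<longleftrightarrow> f x = f y" if "x \<in> verts G" "y \<in> verts G" for x y
    using h that by (auto dest: inj_onD)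
  have "bij_betw (h \<circ> f) (verts g) (h ` f ` verts G)"
    using bij_betw_trans[OF bij inj_on_imp_bij_betw[OF h]] .
  then have "bij_betw (\<lambda>x. h (f x)) (verts g) ((\<lambda>x. h (f x)) ` verts G)"
    by (simp add: comp_def image_image)
  moreover have "quot_black G (\<lambda>x. h (f x)) (h (f a)) (h (f b)) = quot_black G f (f a) (f b)"
       "quot_adj G (\<lambda>x. h (f x)) (h (f a)) (h (f b)) = quot_adj G f (f a) (f b)"
    if "a \<in> verts g" "b \<in> verts g" for a b
  proof -
    have "a \<in> verts G" "b \<in> verts G" using that sub by auto
    then show "quot_black G (\<lambda>x. h (f x)) (h (f a)) (h (f b)) = quot_black G f (f a) (f b)"
       "quot_adj G (\<lambda>x. h (f x)) (h (f a)) (h (f b)) = quot_adj G f (f a) (f b)"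
      unfolding quot_black_def quot_adj_def by (simp_all add: eq)
  qed
  ultimately show ?thesis
    using rep unfolding represents_def by auto
qed

text \<open>The new vertex takes the name \<open>u\<close>, so the representatives stay inside
  \<open>verts G\<close>. The conjunction in the black rule and the disjunction in the adjacency
  rule of \<open>contract\<close> match the behaviour of \<open>quot_black\<close> and
  \<open>quot_adj\<close> on a union of two fibres.\<close>

lemma represents_contract:
  assumes rep: "represents g G f" and u: "u \<in> verts g" and v: "v \<in> verts g" and uv: "u \<noteq> v"
  shows "represents (contract g u v u) G (merge (f v) (f u) f)"
proof -
  let ?g = "contract g u v u" and ?f = "merge (f v) (f u) f"
  have sub: "verts g \<subseteq> verts G" and img: "f ` verts g = f ` verts G" and inj: "inj_on f (verts g)"
    and wf: "wf_trigraph g"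
    using rep by (auto simp: represents_def bij_betw_def)
  have fuv: "f u \<noteq> f v"
    using inj u v uv by (auto dest: inj_onD)
  have V: "verts ?g = verts g - {v}"
    using u uv by (auto simp: contract_def)
  have f_on: "?f a = f a" if "a \<in> verts ?g" for a
    using that V inj v by (auto simp: merge_def dest: inj_onD)
  have img': "?f ` verts ?g = ?f ` verts G"
  proof
    show "?f ` verts ?g \<subseteq> ?f ` verts G"
      using V sub by auto
    show "?f ` verts G \<subseteq> ?f ` verts ?g"
    proof
      fix q assume "q \<in> ?f ` verts G"
      then obtain x where x: "x \<in> verts G" "q = ?f x" by blast
      then obtain a where a: "a \<in> verts g" "f x = f a" using img by blast
      show "q \<in> ?f ` verts ?g"
      proof (cases "a = v")
        case True
        then have "q = ?f u" using x a fuv by (simp add: merge_def)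
        then show ?thesis using V u uv by blast
      next
        case False
        then have "q = ?f a" using x a by (simp add: merge_def)
        then show ?thesis using V a False by blast
      qed
    qed
  qed
  have "inj_on ?f (verts ?g)"
    using inj_on_subset[OF inj, of "verts ?g"] V f_on by (auto simp: inj_on_def)
  then have bij: "bij_betw ?f (verts ?g) (?f ` verts G)"
    using img' by (simp add: bij_betw_def)
  have B: "{a, b} \<in> blacks ?g \<longleftrightarrow> (if a = u then {u, b} \<in> blacks g \<and> {v, b} \<in> blacks g
       else if b = u then {u, a} \<in> blacks g \<and> {v, a} \<in> blacks g else {a, b} \<in> blacks g)"
    if "a \<in> verts ?g" "b \<in> verts ?g" "a \<noteq> b" for a b
    using that V by (auto simp: contract_def doubleton_eq_iff)
  have R: "{a, b} \<in> reds ?g \<longleftrightarrow> (if a = u then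
         \<not> ({u, b} \<in> blacks g \<and> {v, b} \<in> blacks g) \<and>
         ({u, b} \<in> blacks g \<union> reds g \<or> {v, b} \<in> blacks g \<union> reds g)
       else if b = u then \<not> ({u, a} \<in> blacks g \<and> {v, a} \<in> blacks g) \<and>
         ({u, a} \<in> blacks g \<union> reds g \<or> {v, a} \<in> blacks g \<union> reds g)
       else {a, b} \<in> reds g)"
    if "a \<in> verts ?g" "b \<in> verts ?g" "a \<noteq> b" for a b
    using that V by (auto simp: contract_def doubleton_eq_iff)
  have fin: "finite (verts g)" and disj: "blacks g \<inter> reds g = {}"
    using wf by (auto simp: wf_trigraph_def)
  have wf': "wf_trigraph ?g"
  proof -
    have pairs: "e \<in> {{x, y} | x y. x \<in> verts ?g \<and> y \<in> verts ?g \<and> x \<noteq> y}"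
      if e: "e \<in> blacks ?g \<union> reds ?g" for e
    proof -
      consider "e \<in> blacks g \<union> reds g" "u \<notin> e" "v \<notin> e"
        | z where "e = {u, z}" "z \<in> verts g - {u, v}"
        using e unfolding contract_def by auto
      then show ?thesis
      proof cases
        case 1
        then have "e \<in> {{x, y} | x y. x \<in> verts g \<and> y \<in> verts g \<and> x \<noteq> y}"
          using wf by (auto simp: wf_trigraph_def)
        then show ?thesis using 1 V by blast
      next
        case 2
        then show ?thesis using V u uv by blast
      qed
    qed
    have "blacks ?g \<inter> reds ?g = {}"
      using disj by (auto simp: contract_def doubleton_eq_iff)
    then show ?thesis
      using pairs fin V unfolding wf_trigraph_def by (auto simp: subset_iff)
  qed
  have qb: "{a, b} \<in> blacks g \<longleftrightarrow> quot_black G f (f a) (f b)"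
    and qr: "{a, b} \<in> reds g \<longleftrightarrow> quot_adj G f (f a) (f b) \<and> \<not> quot_black G f (f a) (f b)"
    if "a \<in> verts g" "b \<in> verts g" "a \<noteq> b" for a b
    using rep that unfolding represents_def by blast+
  \<comment> \<open>Both classes contain a representative, so \<open>quot_black\<close> does not
    hold vacuously here.\<close>
  have ba: "quot_black G f (f a) (f b) \<Longrightarrow> quot_adj G f (f a) (f b)"
    if "a \<in> verts g" "b \<in> verts g" for a b
    using that sub unfolding quot_black_def quot_adj_def by blast
  have fu: "?f x = f u \<longleftrightarrow> f x = f u \<or> f x = f v" for x
    using fuv by (auto simp: merge_def)
  have fb: "?f x = f b \<longleftrightarrow> f x = f b" if "f b \<noteq> f u" "f b \<noteq> f v" for x b
    using that by (auto simp: merge_def)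
  have mb_u: "quot_black G ?f (f u) (f b) \<longleftrightarrow> quot_black G f (f u) (f b) \<and> quot_black G f (f v) (f b)"
    and ma_u: "quot_adj G ?f (f u) (f b) \<longleftrightarrow> quot_adj G f (f u) (f b) \<or> quot_adj G f (f v) (f b)"
    if "f b \<noteq> f u" "f b \<noteq> f v" for b
    unfolding quot_black_def quot_adj_def fu fb[OF that] by blast+
  have mb: "quot_black G ?f (f a) (f b) \<longleftrightarrow> quot_black G f (f a) (f b)"
    and ma: "quot_adj G ?f (f a) (f b) \<longleftrightarrow> quot_adj G f (f a) (f b)"
    if "f a \<noteq> f u" "f a \<noteq> f v" "f b \<noteq> f u" "f b \<noteq> f v" for a b
    unfolding quot_black_def quot_adj_def fb[OF that(1,2)] fb[OF that(3,4)] by blast+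
  have ne: "f a \<noteq> f b" if "a \<in> verts g" "b \<in> verts g" "a \<noteq> b" for a b
    using inj that by (auto dest: inj_onD)
  have at_u: "({u, b} \<in> blacks ?g \<longleftrightarrow> quot_black G ?f (f u) (f b)) \<and>
        ({u, b} \<in> reds ?g \<longleftrightarrow> quot_adj G ?f (f u) (f b) \<and> \<not> quot_black G ?f (f u) (f b))"
    if b: "b \<in> verts ?g" "b \<noteq> u" for b
  proof -
    have b': "b \<in> verts g" "b \<noteq> u" "b \<noteq> v" using b V by auto
    have u': "u \<in> verts ?g" using V u uv by auto
    have n: "f b \<noteq> f u" "f b \<noteq> f v" using ne b' u v by auto
    show ?thesis
      unfolding mb_u[OF n] ma_u[OF n] B[OF u' b(1) b(2)[symmetric]] R[OF u' b(1) b(2)[symmetric]]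
      using qb[OF u b'(1)] qb[OF v b'(1)] qr[OF u b'(1)] qr[OF v b'(1)] b' ba[OF u b'(1)] ba[OF v b'(1)]
      by auto
  qed
  have "({a, b} \<in> blacks ?g \<longleftrightarrow> quot_black G ?f (?f a) (?f b)) \<and>
        ({a, b} \<in> reds ?g \<longleftrightarrow> quot_adj G ?f (?f a) (?f b) \<and> \<not> quot_black G ?f (?f a) (?f b))"
    if ab: "a \<in> verts ?g" "b \<in> verts ?g" "a \<noteq> b" for a b
  proof -
    consider "a = u" | "b = u" | "a \<noteq> u" "b \<noteq> u" by blast
    then show ?thesis
    proof cases
      case 1
      then show ?thesis using at_u[of b] ab f_on[of b] f_on[of u] by auto
    next
      case 2
      then show ?thesis using at_u[of a] ab f_on[of a] f_on[of u]
        quot_black_commute[of G ?f "f u" "f a"] quot_adj_commute[of G ?f "f u" "f a"]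
        by (auto simp: insert_commute)
    next
      case 3
      have ab': "a \<in> verts g" "b \<in> verts g" "a \<noteq> v" "b \<noteq> v" using ab V by auto
      have n: "f a \<noteq> f u" "f a \<noteq> f v" "f b \<noteq> f u" "f b \<noteq> f v"
        using ne ab' 3 u v by auto
      show ?thesis
        unfolding f_on[OF ab(1)] f_on[OF ab(2)] mb[OF n] ma[OF n] B[OF ab] R[OF ab]
        using 3 qb[OF ab'(1,2) ab(3)] qr[OF ab'(1,2) ab(3)] by auto
    qed
  qed
  then show ?thesis
    unfolding represents_def using wf' bij V sub by blast
qed

text \<open>Chains of merges with bounded red degree at every stage, stated on maps alone. In
  \<open>step\<close> the names \<open>c\<close> and \<open>e\<close> may coincide or be unoccupied,
  so that a mere renaming counts as a step.\<close>

inductive collapsible :: "nat \<Rightarrow> 'v trigraph \<Rightarrow> ('v \<Rightarrow> 'p) \<Rightarrow> bool" for d G where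
  collapsed: "card (f ` verts G) \<le> 1 \<Longrightarrow> (\<And>p. p \<in> f ` verts G \<Longrightarrow> card (quot_red_nbrs G f p) \<le> d)
    \<Longrightarrow> collapsible d G f"
| step: "(\<And>p. p \<in> f ` verts G \<Longrightarrow> card (quot_red_nbrs G f p) \<le> d)
    \<Longrightarrow> collapsible d G (merge c e f) \<Longrightarrow> collapsible d G f"

text \<open>Induction along the chain: a merge of two distinct occupied names is one contraction of
  \<open>g\<close>; any other merge preserves the partition, and \<open>g\<close> represents the new
  map as well.\<close>

lemma d_sequence_if_collapsible:
  assumes "collapsible d G f" and "represents g G f" and fin: "finite (verts G)"
  shows "\<exists>gs. d_sequence d g gs"
  using assms(1,2)
proof (induction arbitrary: g rule: collapsible.induct)
  case (collapsed f)
  have inj: "inj_on f (verts g)" "f ` verts g = f ` verts G" and wf: "wf_trigraph g"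
    using collapsed.prems by (auto simp: represents_def bij_betw_def)
  then have "card (verts g) \<le> 1"
    using collapsed.hyps card_image[of f "verts g"] by auto
  moreover have "\<forall>x\<in>verts g. red_degree g x \<le> d"
    using red_degree_represents_le[OF collapsed.prems fin] collapsed.hyps(2) inj(2)
    by (meson imageI le_trans subsetD collapsed.prems represents_def)
  \<comment> \<open>A contraction sequence has as many entries as there are vertices, so the empty
    trigraph has the empty list.\<close>
  ultimately have "d_sequence d g (if card (verts g) = 0 then [] else [g])"
    by (auto simp: d_sequence_def contraction_seq_def)
  then show ?case by blast
next
  case (step f c e)
  have inj: "inj_on f (verts g)" and img: "f ` verts g = f ` verts G" and wf: "wf_trigraph g"
    using step.prems by (auto simp: represents_def bij_betw_def)
  have deg: "\<forall>x\<in>verts g. red_degree g x \<le> d"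
    using red_degree_represents_le[OF step.prems fin] step.hyps(1) img
    by (meson imageI le_trans subsetD step.prems represents_def)
  show ?case
  proof (cases "c \<in> f ` verts G \<and> e \<in> f ` verts G \<and> c \<noteq> e")
    case True
    then obtain u v where uv: "u \<in> verts g" "v \<in> verts g" "f u = e" "f v = c" "u \<noteq> v"
      using img by (metis imageE)
    let ?g = "contract g u v u"
    have "represents ?g G (merge c e f)"
      using represents_contract[OF step.prems uv(1,2,5)] uv by simp
    then obtain gs where gs: "d_sequence d ?g gs"
      using step.IH by blast
    have V: "verts ?g = verts g - {v}" using uv by (auto simp: contract_def)
    have fing: "finite (verts g)" using wf by (simp add: wf_trigraph_def)
    then have card: "card (verts g) = Suc (card (verts ?g))"
      unfolding V using card.remove[OF _ uv(2)] by blast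
    have card0: "card (verts ?g) \<noteq> 0"
      unfolding V using fing uv by (subst card_0_eq) auto
    have "is_contraction g ?g"
      unfolding is_contraction_def using uv by blast
    moreover have "gs \<noteq> []" "hd gs = ?g"
      using gs card0 by (auto simp: d_sequence_def contraction_seq_def)
    ultimately have "contraction_seq g (g # gs)"
      using gs card unfolding d_sequence_def contraction_seq_def
      by (auto simp: nth_Cons hd_conv_nth split: nat.split)
    then have "d_sequence d g (g # gs)"
      using gs deg by (auto simp: d_sequence_def)
    then show ?thesis by blast
  next
    case False
    \<comment> \<open>On occupied names the merge is the identity, or it renames \<open>c\<close> to
      the unoccupied name \<open>e\<close>.\<close>
    then have "inj_on (\<lambda>p. if p = c then e else p) (f ` verts G)"
      by (auto simp: inj_on_def)
    from represents_relabel[OF step.prems this] have "represents g G (merge c e f)"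
      by (simp add: merge_def)
    then show ?thesis using step.IH by blast
  qed
qed

lemma represents_self:
  assumes "wf_trigraph G" "inj_on f (verts G)"
  shows "represents G G f"
proof -
  have eq: "f x = f y \<longleftrightarrow> x = y" if "x \<in> verts G" "y \<in> verts G" for x y
    using assms(2) that by (auto dest: inj_onD)
  have "({a, b} \<in> blacks G \<longleftrightarrow> quot_black G f (f a) (f b)) \<and>
        ({a, b} \<in> reds G \<longleftrightarrow> quot_adj G f (f a) (f b) \<and> \<not> quot_black G f (f a) (f b))"
    if "a \<in> verts G" "b \<in> verts G" for a b
  proof -
    have "quot_black G f (f a) (f b) \<longleftrightarrow> {a, b} \<in> blacks G"
      using that eq unfolding quot_black_def by auto
    moreover have "quot_adj G f (f a) (f b) \<longleftrightarrow> {a, b} \<in> blacks G \<union> reds G"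
      using that eq unfolding quot_adj_def by auto
    ultimately show ?thesis using assms(1) by (auto simp: wf_trigraph_def)
  qed
  then show ?thesis
    using assms by (simp add: represents_def bij_betw_def)
qed

text \<open>The starting map is any injection rather than the identity, because names live in a
  different type from the vertices.\<close>

lemma tww_le_if_collapsible:
  assumes "wf_trigraph G" "inj_on f (verts G)" "collapsible d G f"
  shows "tww G \<le> d"
proof -
  have "finite (verts G)" using assms(1) by (simp add: wf_trigraph_def)
  from d_sequence_if_collapsible[OF assms(3) represents_self[OF assms(1,2)] this]
  show ?thesis unfolding tww_def by (auto intro: Least_le)
qed

subsection \<open>Collapsing a binary tree\<close>

text \<open>The tree node (h, m) is the m-th node of height h.\<close>
definition tree_parent :: "nat \<times> nat \<Rightarrow> nat \<times> nat" where
  "tree_parent a = (Suc (fst a), snd a div 2)"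

text \<open>Equality is included because adjacent vertices of \<open>G\<close> may share a node, for
  instance while a walk waits at the root.\<close>

definition tree_near :: "(nat \<times> nat) + 'b \<Rightarrow> (nat \<times> nat) + 'b \<Rightarrow> bool" where
  "tree_near p q \<longleftrightarrow>
     (\<exists>a b. p = Inl a \<and> q = Inl b \<and> (a = b \<or> a = tree_parent b \<or> b = tree_parent a))"

text \<open>A homomorphism from \<open>G\<close> to the full binary tree of height \<open>k\<close>
  with a loop at every node. Leaves have height 0 and the root is \<open>(k, 0)\<close>.\<close>

definition tree_map :: "nat \<Rightarrow> 'v trigraph \<Rightarrow> ('v \<Rightarrow> (nat \<times> nat) + 'b) \<Rightarrow> bool" where
  "tree_map k G f \<longleftrightarrow>
     (\<forall>v\<in>verts G. \<exists>h m. f v = Inl (h, m) \<and> h \<le> k \<and> m < 2 ^ (k - h)) \<and>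
     (\<forall>v\<in>verts G. \<forall>w\<in>verts G. {v, w} \<in> blacks G \<union> reds G \<longrightarrow> tree_near (f v) (f w))"

lemma tree_near_sym: "tree_near p q \<Longrightarrow> tree_near q p"
  by (auto simp: tree_near_def)

lemma tree_near_cases:
  assumes "tree_near (Inl (h, m)) q"
  shows "q = Inl (h, m) \<or> q = Inl (Suc h, m div 2) \<or>
    (\<exists>h'. h = Suc h' \<and> (q = Inl (h', 2 * m) \<or> q = Inl (h', 2 * m + 1)))"
proof -
  obtain b where q: "q = Inl b"
    and b: "(h, m) = b \<or> (h, m) = tree_parent b \<or> b = tree_parent (h, m)"
    using assms by (auto simp: tree_near_def)
  have "m' = 2 * (m' div 2) \<or> m' = 2 * (m' div 2) + 1" for m' :: nat
    by presburger
  then show ?thesis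
    using b q by (cases b) (auto simp: tree_parent_def)
qed

lemma card_le_if_subset_list: "A \<subseteq> set xs \<Longrightarrow> card A \<le> length xs"
  by (meson List.finite_set card_length card_mono le_trans)

lemma tree_map_red_nbrs:
  assumes "tree_map k G f" "p \<in> f ` verts G"
  shows "card (quot_red_nbrs G f p) \<le> 3"
proof -
  obtain h m where p: "p = Inl (h, m)"
    using assms by (auto simp: tree_map_def)
  \<comment> \<open>For \<open>h = 0\<close> the two child entries are meaningless, but a longer
    list does no harm to an upper bound.\<close>
  have "quot_red_nbrs G f p \<subseteq> set [Inl (Suc h, m div 2), Inl (h - 1, 2 * m), Inl (h - 1, 2 * m + 1)]"
  proof
    fix q assume q: "q \<in> quot_red_nbrs G f p"
    then have "q \<noteq> p" "tree_near p q"
      using assms(1) by (auto simp: quot_red_nbrs_def quot_adj_def tree_map_def)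
    then show "q \<in> set [Inl (Suc h, m div 2), Inl (h - 1, 2 * m), Inl (h - 1, 2 * m + 1)]"
      using tree_near_cases[of h m q] p by auto
  qed
  from card_le_if_subset_list[OF this] show ?thesis by simp
qed

text \<open>Every quotient on the way is again a \<open>tree_map\<close>, so red degrees stay at
  most 3. The total distance of the vertices from the root level drops with each merge; when it is
  0, all vertices lie on the root.\<close>

lemma collapsible_tree_map:
  assumes fin: "finite (verts G)" and "tree_map k G f" and d: "3 \<le> d"
  shows "collapsible d G f"
  using assms(2)
proof (induction "\<Sum>v\<in>verts G. k - fst (projl (f v))" arbitrary: f rule: less_induct)
  case less
  have deg: "card (quot_red_nbrs G f p) \<le> d" if "p \<in> f ` verts G" for p
    using tree_map_red_nbrs[OF less.prems that] d by simp
  have tm: "\<exists>h m. f v = Inl (h, m) \<and> h \<le> k \<and> m < 2 ^ (k - h)" if "v \<in> verts G" for v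
    using less.prems that by (auto simp: tree_map_def)
  show ?case
  proof (cases "\<exists>v\<in>verts G. fst (projl (f v)) < k")
    case False
    have "f ` verts G \<subseteq> {Inl (k, 0)}"
      using tm False by fastforce
    then have "card (f ` verts G) \<le> 1"
      by (metis One_nat_def card_mono card.empty card.insert empty_iff finite.emptyI finite.insertI)
    then show ?thesis using deg by (rule collapsed)
  next
    case True
    \<comment> \<open>An occupied node of least height has no occupied children, so moving its whole
      class to the parent keeps adjacent vertices near each other.\<close>
    define v where "v = arg_min_on (\<lambda>v. fst (projl (f v))) (verts G)"
    have v: "v \<in> verts G" and vmin: "fst (projl (f v)) \<le> fst (projl (f w))" if "w \<in> verts G" for w
      unfolding v_def using fin that by (auto intro: arg_min_if_finite(1) arg_min_least)
    have vV: "v \<in> verts G" using True v by blast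
    obtain h m where fv: "f v = Inl (h, m)" "m < 2 ^ (k - h)" and hk: "h < k"
      using tm[OF vV] True vmin by fastforce
    let ?f = "merge (Inl (h, m)) (Inl (Suc h, m div 2)) f"
    have m2: "m div 2 < 2 ^ (k - Suc h)"
    proof -
      have "(2::nat) ^ (k - h) = 2 * 2 ^ (k - Suc h)"
        using hk by (metis Suc_diff_Suc power_Suc)
      then show ?thesis using fv(2) by linarith
    qed
    have near: "tree_near (?f x) (?f y)"
      if "x \<in> verts G" "y \<in> verts G" "{x, y} \<in> blacks G \<union> reds G" for x y
    proof -
      have n: "tree_near (f x) (f y)"
        using less.prems that by (auto simp: tree_map_def)
      \<comment> \<open>Since (h, m) has minimal height, its only possible neighbour is its parent.\<close>
      have up: "f w = Inl (h, m) \<or> f w = Inl (Suc h, m div 2)"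
        if "w \<in> verts G" "tree_near (Inl (h, m)) (f w)" for w
        using tree_near_cases[OF that(2)] vmin[OF that(1)] fv(1) by auto
      have refl: "tree_near (Inl a) (Inl a)" for a by (simp add: tree_near_def)
      show ?thesis
        using n up[of x] up[of y] that tree_near_sym[OF n] refl
        by (auto simp: merge_def)
    qed
    have "tree_map k G ?f"
      unfolding tree_map_def
    proof (intro conjI ballI impI)
      fix x assume "x \<in> verts G"
      then show "\<exists>h m. ?f x = Inl (h, m) \<and> h \<le> k \<and> m < 2 ^ (k - h)"
        using tm[of x] m2 hk by (auto simp: merge_def)
    qed (use near in blast)
    moreover have "(\<Sum>v\<in>verts G. k - fst (projl (?f v))) < (\<Sum>v\<in>verts G. k - fst (projl (f v)))"
    proof (rule sum_strict_mono_ex1[OF fin])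
      show "\<forall>x\<in>verts G. k - fst (projl (?f x)) \<le> k - fst (projl (f x))"
        by (auto simp: merge_def)
      show "\<exists>a\<in>verts G. k - fst (projl (?f a)) < k - fst (projl (f a))"
        using vV fv hk by (intro bexI[of _ v]) (auto simp: merge_def)
    qed
    ultimately have "collapsible d G ?f"
      by (rule less.hyps[rotated])
    then show ?thesis using deg by (rule step[rotated])
  qed
qed

subsection \<open>Folding the subdivided edges onto the tree\<close>

text \<open>\<open>long\<close> is the bound of \<open>2 * k - 1\<close> on the number of
  subdivisions without truncated subtraction. \<open>k_pos\<close> separates the root from the
  leaves.\<close>

locale subdivided_trigraph =
  fixes V :: "('a::linorder) set" and E :: "'a set set" and s :: "'a \<Rightarrow> 'a \<Rightarrow> nat"
    and G :: "('a + ('a \<times> 'a \<times> nat)) trigraph" and k :: nat and idx :: "'a \<Rightarrow> nat"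
  assumes graph: "simple_graph V E"
    and idx_inj: "inj_on idx V" and idx_less: "\<And>v. v \<in> V \<Longrightarrow> idx v < 2 ^ k"
    and k_pos: "0 < k"
    and long: "\<And>x y. x < y \<Longrightarrow> {x, y} \<in> E \<Longrightarrow> 2 * k \<le> s x y + 1"
    and verts_G: "verts G = subdiv_verts V E s"
    and edges_G: "blacks G \<union> reds G = subdiv_edges E s"
    and disj_G: "blacks G \<inter> reds G = {}"
    and red_le: "\<And>x. x \<in> verts G \<Longrightarrow> red_degree G x \<le> 4"
    and red_eq: "\<And>x. x \<in> verts G \<Longrightarrow> red_degree G x = 4 \<Longrightarrow> \<not> (\<exists>e \<in> blacks G. x \<in> e)"
begin

definition edge_pairs :: "('a \<times> 'a) set" where
  "edge_pairs = {(x, y). x < y \<and> {x, y} \<in> E}"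

definition anc :: "'a \<Rightarrow> nat \<Rightarrow> nat \<times> nat" where
  "anc x h = (h, idx x div 2 ^ h)"

text \<open>The walk in the tree from leaf x up to the root (waiting there if the path is longer
  than needed) and down to leaf y.\<close>
definition walk :: "'a \<Rightarrow> 'a \<Rightarrow> nat \<Rightarrow> nat \<times> nat" where
  "walk x y j = (if j \<le> k then anc x j else anc y (min k (s x y + 1 - j)))"

text \<open>The first c (x, y) subdivision vertices of each edge have been folded onto the tree.\<close>
definition zip_map :: "('a \<times> 'a \<Rightarrow> nat) \<Rightarrow> 'a + ('a \<times> 'a \<times> nat) \<Rightarrow> (nat \<times> nat) + ('a \<times> 'a \<times> nat)"
  where "zip_map c v = (case v of Inl u \<Rightarrow> Inl (anc u 0)
     | Inr (x, y, j) \<Rightarrow> if j \<le> c (x, y) then Inl (walk x y j) else Inr (x, y, j))"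

text \<open>Only the path of the edge e may be partially folded.\<close>
definition zip_state :: "('a \<times> 'a \<Rightarrow> nat) \<Rightarrow> 'a \<times> 'a \<Rightarrow> bool" where
  "zip_state c e \<longleftrightarrow> (\<forall>(x, y)\<in>edge_pairs. c (x, y) \<le> s x y \<and>
     ((x, y) \<noteq> e \<longrightarrow> c (x, y) = 0 \<or> c (x, y) = s x y))"

abbreviation sv :: "'a \<Rightarrow> 'a \<Rightarrow> nat \<Rightarrow> 'a + ('a \<times> 'a \<times> nat)" where
  "sv x y i \<equiv> sub_vertex x y (s x y) i"

section \<open>Vertices and edges of the subdivision\<close>

lemma edge_pairsD:
  assumes "(x, y) \<in> edge_pairs"
  shows "x \<in> V" "y \<in> V" "x \<noteq> y" "2 * k \<le> s x y + 1" "1 \<le> s x y" "k \<le> s x y"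
proof -
  have E: "x < y" "{x, y} \<in> E" using assms by (auto simp: edge_pairs_def)
  then have "{x, y} \<in> {{x, y} | x y. x \<in> V \<and> y \<in> V \<and> x \<noteq> y}"
    using graph unfolding simple_graph_def by blast
  then show "x \<in> V" "y \<in> V" "x \<noteq> y" by (auto simp: doubleton_eq_iff)
  show *: "2 * k \<le> s x y + 1" using long E by blast
  show "1 \<le> s x y" "k \<le> s x y" using * k_pos by linarith+
qed

lemma finite_V: "finite V"
  using graph by (simp add: simple_graph_def)

lemma finite_edge_pairs: "finite edge_pairs"
  by (rule finite_subset[of _ "V \<times> V"]) (auto dest: edge_pairsD simp: finite_V)

lemma verts_eq: "verts G = Inl ` V \<union> {Inr (x, y, i) | x y i. (x, y) \<in> edge_pairs \<and> 1 \<le> i \<and> i \<le> s x y}"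
  by (auto simp: verts_G subdiv_verts_def edge_pairs_def)

lemma finite_verts: "finite (verts G)"
proof -
  have "verts G \<subseteq> Inl ` V \<union> (\<Union>(x, y)\<in>edge_pairs. (\<lambda>i. Inr (x, y, i)) ` {..s x y})"
    by (auto simp: verts_eq)
  then show ?thesis
    by (rule finite_subset) (auto simp: finite_V finite_edge_pairs)
qed

lemma sv_mem: "(x, y) \<in> edge_pairs \<Longrightarrow> i \<le> Suc (s x y) \<Longrightarrow> sv x y i \<in> verts G"
  by (auto simp: sub_vertex_def verts_eq dest: edge_pairsD)

lemma sv_neq: "(x, y) \<in> edge_pairs \<Longrightarrow> i \<le> s x y \<Longrightarrow> sv x y i \<noteq> sv x y (Suc i)"
  by (auto simp: sub_vertex_def dest: edge_pairsD)

lemma edge_iff: "e \<in> blacks G \<union> reds G \<longleftrightarrow>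
    (\<exists>x y i. (x, y) \<in> edge_pairs \<and> i \<le> s x y \<and> e = {sv x y i, sv x y (Suc i)})"
  unfolding edges_G subdiv_edges_def edge_pairs_def by auto

lemma wf_G: "wf_trigraph G"
proof -
  have "e \<in> {{x, y} | x y. x \<in> verts G \<and> y \<in> verts G \<and> x \<noteq> y}" if e: "e \<in> blacks G \<union> reds G" for e
  proof -
    obtain x y i where "(x, y) \<in> edge_pairs" "i \<le> s x y" "e = {sv x y i, sv x y (Suc i)}"
      using e unfolding edge_iff by blast
    moreover from this have "sv x y i \<in> verts G" "sv x y (Suc i) \<in> verts G"
      "sv x y i \<noteq> sv x y (Suc i)"
      using sv_mem sv_neq by simp_all
    ultimately show ?thesis by blast
  qed
  then show ?thesis
    unfolding wf_trigraph_def using finite_verts disj_G by blast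
qed

section \<open>Walks in the tree\<close>

lemma anc_top: "x \<in> V \<Longrightarrow> anc x k = (k, 0)"
  by (simp add: anc_def idx_less)

lemma anc_Suc: "anc x (Suc h) = tree_parent (anc x h)"
  by (simp add: anc_def tree_parent_def power_Suc2 div_mult2_eq del: power_Suc)

lemma tree_near_refl: "tree_near (Inl a) (Inl a)"
  by (simp add: tree_near_def)

lemma tree_near_anc: "tree_near (Inl (anc x h)) (Inl (anc x (Suc h)))"
  by (simp add: tree_near_def anc_Suc)

lemma walk_near:
  assumes "(x, y) \<in> edge_pairs" "i \<le> s x y"
  shows "tree_near (Inl (walk x y i)) (Inl (walk x y (Suc i)))"
proof -
  note e = edge_pairsD[OF assms(1)]
  have down: "tree_near (Inl (anc y (min k (Suc h)))) (Inl (anc y (min k h)))" for h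
  proof (cases "h < k")
    case True
    then have "min k (Suc h) = Suc h" "min k h = h" by auto
    then show ?thesis
      using tree_near_sym[OF tree_near_anc[of y h]] by simp
  next
    case False
    then show ?thesis by (simp add: tree_near_refl)
  qed
  consider "i < k" | "i = k" | "k < i" by linarith
  then show ?thesis
  proof cases
    case 1
    then show ?thesis by (simp add: walk_def tree_near_anc)
  next
    case 2
    \<comment> \<open>The walk switches from ancestors of \<open>x\<close> to ancestors of
      \<open>y\<close> here. By the length bound the descent has not begun at position
      \<open>k\<close>, so both ancestors are the root.\<close>
    have "min k (Suc (s x y - k)) = k" using e(4) by auto
    then show ?thesis
      using 2 down[of "s x y - k"] anc_top e(1,2) by (simp add: walk_def)
  next
    case 3
    then show ?thesis
      using down[of "s x y - i"] assms(2) by (simp add: walk_def Suc_diff_le)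
  qed
qed

lemma walk_0: "walk x y 0 = anc x 0"
  by (simp add: walk_def)

lemma walk_end: "(x, y) \<in> edge_pairs \<Longrightarrow> walk x y (Suc (s x y)) = anc y 0"
  by (auto simp: walk_def dest: edge_pairsD)

lemma walk_inner:
  assumes "1 \<le> i" "i \<le> s x y"
  shows "fst (walk x y i) \<noteq> 0"
  using assms k_pos by (auto simp: walk_def anc_def)

lemma walk_bounds:
  assumes "(x, y) \<in> edge_pairs"
  shows "\<exists>h m. walk x y i = (h, m) \<and> h \<le> k \<and> m < 2 ^ (k - h)"
proof -
  have "idx u div 2 ^ h < 2 ^ (k - h)" if "u \<in> V" "h \<le> k" for u h
    using idx_less[OF that(1)] that(2)
    by (simp add: less_mult_imp_div_less flip: power_add)
  then show ?thesis
    using edge_pairsD[OF assms] by (auto simp: walk_def anc_def)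
qed

section \<open>Partially folded paths\<close>

lemma zip_map_sv:
  assumes "(x, y) \<in> edge_pairs" "i \<le> Suc (s x y)"
  shows "zip_map c (sv x y i) =
    (if i \<le> c (x, y) \<or> i = 0 \<or> i = Suc (s x y) then Inl (walk x y i) else Inr (x, y, i))"
proof -
  consider "i = 0" | "i = Suc (s x y)" | "i \<noteq> 0" "i \<noteq> Suc (s x y)" by blast
  then show ?thesis
    by cases (auto simp: sub_vertex_def zip_map_def walk_0 walk_end[OF assms(1)])
qed

lemma zip_map_eq_Inr: "zip_map c v = Inr (x, y, j) \<Longrightarrow> v = Inr (x, y, j)"
  by (auto simp: zip_map_def split: sum.splits if_splits)

text \<open>Inner positions of a walk have positive height, so no subdivision vertex is ever folded
  onto a leaf. With \<open>idx\<close> injective, the class of an occupied leaf is a single vertex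
  of H.\<close>

lemma zip_map_eq_leaf:
  assumes "v \<in> verts G" "zip_map c v = Inl (0, m)"
  shows "\<exists>u\<in>V. v = Inl u \<and> m = idx u"
proof -
  have "fst (walk x y j) = 0 \<Longrightarrow> 1 \<le> j \<Longrightarrow> j \<le> s x y \<Longrightarrow> False" for x y j
    using walk_inner by blast
  then show ?thesis
    using assms by (fastforce simp: verts_eq zip_map_def anc_def split: if_splits)
qed

text \<open>An edge of \<open>G\<close> lies in the folded part, leaves it, or starts at an unfolded
  vertex. Paths other than \<open>e0\<close> are folded entirely or not at all, so an edge leaving
  the folded part belongs to \<open>e0\<close> or starts at a leaf.\<close>

lemma zip_map_edge_cases:
  assumes c: "zip_state c e0" and e: "(x, y) \<in> edge_pairs" and i: "i \<le> s x y"
  obtains (tree) "tree_near (zip_map c (sv x y i)) (zip_map c (sv x y (Suc i)))"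
  | (frontier) "i = c (x, y)" "zip_map c (sv x y i) = Inl (walk x y i)"
      "zip_map c (sv x y (Suc i)) = Inr (x, y, Suc i)" "i = 0 \<or> (x, y) = e0"
  | (path) "zip_map c (sv x y i) = Inr (x, y, i)"
      "zip_map c (sv x y (Suc i)) = Inr (x, y, Suc i) \<or> zip_map c (sv x y (Suc i)) = Inl (anc y 0)"
proof -
  have c': "c (x, y) \<le> s x y" "(x, y) \<noteq> e0 \<Longrightarrow> c (x, y) = 0 \<or> c (x, y) = s x y"
    using c e by (auto simp: zip_state_def)
  have z: "zip_map c (sv x y i) = (if i \<le> c (x, y) \<or> i = 0 then Inl (walk x y i) else Inr (x, y, i))"
    "zip_map c (sv x y (Suc i)) =
      (if Suc i \<le> c (x, y) \<or> i = s x y then Inl (walk x y (Suc i)) else Inr (x, y, Suc i))"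
    using zip_map_sv[OF e, of i] zip_map_sv[OF e, of "Suc i"] i by auto
  consider "Suc i \<le> c (x, y) \<or> i = c (x, y) \<and> i = s x y" | "i = c (x, y)" "i \<noteq> s x y" | "c (x, y) < i"
    by linarith
  then show thesis
  proof cases
    case 1
    then show thesis using tree walk_near[OF e i] z by auto
  next
    case 2
    then show thesis using frontier c' z by auto
  next
    case 3
    then show thesis using path z walk_end[OF e] by auto
  qed
qed

lemma quot_adj_zip_mapE:
  assumes "quot_adj G (zip_map c) p q"
  obtains x y i where "(x, y) \<in> edge_pairs" "i \<le> s x y"
    "p = zip_map c (sv x y i) \<and> q = zip_map c (sv x y (Suc i)) \<or>
     q = zip_map c (sv x y i) \<and> p = zip_map c (sv x y (Suc i))"
proof -
  obtain v w where "zip_map c v = p" "zip_map c w = q" "{v, w} \<in> blacks G \<union> reds G"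
    using assms unfolding quot_adj_def by blast
  with that show thesis
    unfolding edge_iff by (auto simp: doubleton_eq_iff)
qed

section \<open>Red degrees during the folding\<close>

lemma card_red_nbrs_sub: "card (quot_red_nbrs G (zip_map c) (Inr (x, y, j))) \<le> 4"
proof -
  \<comment> \<open>An unfolded subdivision vertex is alone in its class, so only its two neighbours
    on the path can contribute.\<close>
  have "quot_red_nbrs G (zip_map c) (Inr (x, y, j))
      \<subseteq> set [zip_map c (sv x y (j - 1)), zip_map c (sv x y (Suc j))]"
  proof
    fix q assume "q \<in> quot_red_nbrs G (zip_map c) (Inr (x, y, j))"
    then have "quot_adj G (zip_map c) (Inr (x, y, j)) q" by (simp add: quot_red_nbrs_def)
    then obtain x' y' i where e: "(x', y') \<in> edge_pairs" "i \<le> s x' y'" and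
      "Inr (x, y, j) = zip_map c (sv x' y' i) \<and> q = zip_map c (sv x' y' (Suc i)) \<or>
       q = zip_map c (sv x' y' i) \<and> Inr (x, y, j) = zip_map c (sv x' y' (Suc i))"
      by (rule quot_adj_zip_mapE)
    then show "q \<in> set [zip_map c (sv x y (j - 1)), zip_map c (sv x y (Suc j))]"
      using zip_map_sv[OF e(1), of i c] zip_map_sv[OF e(1), of "Suc i" c]
      by (auto split: if_splits)
  qed
  from card_le_if_subset_list[OF this] show ?thesis by simp
qed

text \<open>The four possible neighbours are the parent, the two children and the first unfolded
  vertex of the path \<open>e0\<close>.\<close>

lemma card_red_nbrs_inner:
  assumes c: "zip_state c e0"
  shows "card (quot_red_nbrs G (zip_map c) (Inl (Suc h, m))) \<le> 4"
proof -
  obtain x0 y0 where e0: "e0 = (x0, y0)" by (cases e0)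
  let ?N = "[Inl (Suc (Suc h), m div 2), Inl (h, 2 * m), Inl (h, 2 * m + 1), Inr (x0, y0, Suc (c e0))]"
  have "quot_red_nbrs G (zip_map c) (Inl (Suc h, m)) \<subseteq> set ?N"
  proof
    fix q assume q: "q \<in> quot_red_nbrs G (zip_map c) (Inl (Suc h, m))"
    let ?p = "Inl (Suc h, m) :: (nat \<times> nat) + ('a \<times> 'a \<times> nat)"
    have qp: "q \<noteq> ?p" and "quot_adj G (zip_map c) ?p q"
      using q by (auto simp: quot_red_nbrs_def)
    from this(2) obtain x y i where e: "(x, y) \<in> edge_pairs" "i \<le> s x y" and
      pq: "?p = zip_map c (sv x y i) \<and> q = zip_map c (sv x y (Suc i)) \<or>
       q = zip_map c (sv x y i) \<and> ?p = zip_map c (sv x y (Suc i))"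
      by (rule quot_adj_zip_mapE)
    show "q \<in> set ?N"
      using c e
    proof (cases rule: zip_map_edge_cases)
      case tree
      then have "tree_near ?p q" using pq by (auto dest: tree_near_sym)
      then show ?thesis using tree_near_cases qp by fastforce
    next
      case frontier
      then have "walk x y i = (Suc h, m)" using pq by auto
      \<comment> \<open>Position 0 is a leaf and this node is not, so the edge belongs to
        \<open>e0\<close>.\<close>
      then have "i \<noteq> 0" by (cases i) (auto simp: walk_0 anc_def)
      then show ?thesis using frontier pq e0 by auto
    next
      case path
      then show ?thesis using pq by (auto simp: anc_def)
    qed
  qed
  from card_le_if_subset_list[OF this] show ?thesis by simp
qed

lemma card_red_neighbours: "card {w. {v, w} \<in> reds G} = red_degree G v"
proof -
  have "bij_betw (\<lambda>w. {v, w}) {w. {v, w} \<in> reds G} {e \<in> reds G. v \<in> e}"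
  proof (rule bij_betw_imageI)
    show "inj_on (\<lambda>w. {v, w}) {w. {v, w} \<in> reds G}"
      by (auto simp: inj_on_def doubleton_eq_iff)
    show "(\<lambda>w. {v, w}) ` {w. {v, w} \<in> reds G} = {e \<in> reds G. v \<in> e}"
    proof (intro set_eqI iffI)
      fix e assume e: "e \<in> {e \<in> reds G. v \<in> e}"
      then obtain b where "e = {v, b}" using wf_trigraph_edgeE[OF wf_G, of e v] by blast
      then show "e \<in> (\<lambda>w. {v, w}) ` {w. {v, w} \<in> reds G}" using e by blast
    qed auto
  qed
  then show ?thesis unfolding red_degree_def by (rule bij_betw_same_card)
qed

text \<open>The class is the single vertex \<open>u\<close>. Apart from the parent, its red
  neighbours come from red edges at \<open>u\<close> in \<open>G\<close>, because a black edge to an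
  unfolded vertex joins two singleton classes and stays black.\<close>

lemma card_red_nbrs_leaf:
  assumes c: "zip_state c e0" and u: "u \<in> V"
  shows "card (quot_red_nbrs G (zip_map c) (Inl (0, idx u))) \<le> 4"
proof -
  let ?p = "Inl (0, idx u) :: (nat \<times> nat) + ('a \<times> 'a \<times> nat)"
  let ?par = "Inl (1, idx u div 2) :: (nat \<times> nat) + ('a \<times> 'a \<times> nat)"
  let ?R = "{w. {Inl u, w} \<in> reds G}"
  let ?N = "quot_red_nbrs G (zip_map c) ?p"
  have uG: "Inl u \<in> verts G" using u by (simp add: verts_eq)
  have finR: "finite ?R"
    by (rule finite_subset[OF _ finite_verts]) (use wf_trigraph_edgeD(2)[OF wf_G] in blast)
  have leaf: "v = Inl u" if "v \<in> verts G" "zip_map c v = ?p" for v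
    using zip_map_eq_leaf[OF that] idx_inj u by (auto dest: inj_onD)
  have key: "\<exists>w. q = zip_map c w \<and> {Inl u, w} \<in> blacks G \<union> reds G \<and>
      ({Inl u, w} \<in> reds G \<or> q = ?par)" if q: "q \<in> ?N" for q
  proof -
    have qp: "q \<noteq> ?p" and adj: "quot_adj G (zip_map c) ?p q" and nb: "\<not> quot_black G (zip_map c) ?p q"
      using q by (auto simp: quot_red_nbrs_def)
    from adj obtain v w where vw: "v \<in> verts G" "w \<in> verts G" "zip_map c v = ?p" "zip_map c w = q"
      "{v, w} \<in> blacks G \<union> reds G"
      unfolding quot_adj_def by blast
    have v: "v = Inl u" using leaf vw by blast
    have "{Inl u, w} \<in> reds G \<or> q = ?par"
    proof (cases q)
      \<comment> \<open>The neighbour is a tree node; a leaf has no children, which leaves the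
        parent.\<close>
      case (Inl a)
      from adj obtain x y i where e: "(x, y) \<in> edge_pairs" "i \<le> s x y" and
        pq: "?p = zip_map c (sv x y i) \<and> q = zip_map c (sv x y (Suc i)) \<or>
         q = zip_map c (sv x y i) \<and> ?p = zip_map c (sv x y (Suc i))"
        by (rule quot_adj_zip_mapE)
      from c e have "tree_near ?p q"
        by (cases rule: zip_map_edge_cases) (use pq Inl in \<open>auto dest: tree_near_sym\<close>)
      then show ?thesis using tree_near_cases qp by fastforce
    next
      case (Inr a)
      \<comment> \<open>The class of \<open>w\<close> is a singleton as well, so a black edge would
        give \<open>quot_black\<close>, contrary to \<open>nb\<close>.\<close>
      have "w' = w" if "zip_map c w' = q" for w'
        using that vw(4) Inr zip_map_eq_Inr by (metis prod_cases3)
      then have "{Inl u, w} \<notin> blacks G"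
        using nb leaf unfolding quot_black_def by blast
      then show ?thesis using vw v by auto
    qed
    then show ?thesis using vw v by (intro exI[of _ w]) auto
  qed
  have cR: "card (zip_map c ` ?R) \<le> red_degree G (Inl u)"
    using card_image_le[OF finR, of "zip_map c"] card_red_neighbours[of "Inl u"] by simp
  show ?thesis
  proof (cases "red_degree G (Inl u) = 4")
    case True
    \<comment> \<open>All edges at u are red, so the tree edge, if present, replaces one of them.\<close>
    have "{Inl u, w} \<notin> blacks G" for w using red_eq[OF uG True] by auto
    then have "?N \<subseteq> zip_map c ` ?R" using key by blast
    then show ?thesis
      using cR True card_mono[of "zip_map c ` ?R" ?N] finR by (simp add: le_trans)
  next
    case False
    \<comment> \<open>With at most three red edges at \<open>u\<close> there is room for the parent
      as a fourth neighbour.\<close>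
    then have "red_degree G (Inl u) \<le> 3" using red_le[OF uG] by linarith
    moreover have "?N \<subseteq> insert ?par (zip_map c ` ?R)" using key by blast
    then have "card ?N \<le> card (insert ?par (zip_map c ` ?R))"
      using finR by (intro card_mono) auto
    moreover have "\<dots> \<le> Suc (card (zip_map c ` ?R))"
      using finR by (simp add: card_insert_if)
    ultimately show ?thesis using cR by linarith
  qed
qed

lemma card_red_nbrs_zip:
  assumes c: "zip_state c e0" and p: "p \<in> zip_map c ` verts G"
  shows "card (quot_red_nbrs G (zip_map c) p) \<le> 4"
proof (cases p)
  case (Inr a)
  then show ?thesis using card_red_nbrs_sub by (cases a) auto
next
  case (Inl a)
  show ?thesis
  proof (cases "fst a")
    case 0
    then have pm: "p = Inl (0, snd a)" using Inl by (cases a) simp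
    then obtain v where "v \<in> verts G" "zip_map c v = Inl (0, snd a)" using p by auto
    then obtain u where "u \<in> V" "p = Inl (0, idx u)"
      using zip_map_eq_leaf pm by blast
    then show ?thesis using card_red_nbrs_leaf[OF c] by blast
  next
    case (Suc h)
    then have "p = Inl (Suc h, snd a)" using Inl by (cases a) simp
    then show ?thesis using card_red_nbrs_inner[OF c] by simp
  qed
qed

section \<open>The folding process\<close>

lemma zip_map_step:
  "zip_map (c((x, y) := Suc (c (x, y)))) =
     merge (Inr (x, y, Suc (c (x, y)))) (Inl (walk x y (Suc (c (x, y))))) (zip_map c)"
proof
  fix v
  show "zip_map (c((x, y) := Suc (c (x, y)))) v =
     merge (Inr (x, y, Suc (c (x, y)))) (Inl (walk x y (Suc (c (x, y))))) (zip_map c) v"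
  proof (cases v)
    case (Inl u)
    then show ?thesis by (simp add: zip_map_def merge_def)
  next
    case (Inr a)
    obtain x' y' j where a: "a = (x', y', j)" by (cases a)
    show ?thesis
      \<comment> \<open>The name of an unfolded vertex is carried by that vertex alone, so raising
        the counter by one changes the map only there.\<close>
      by (cases "(x', y') = (x, y)") (auto simp: Inr a zip_map_def merge_def le_Suc_eq)
  qed
qed

lemma tree_map_zip_map:
  assumes full: "\<And>x y. (x, y) \<in> edge_pairs \<Longrightarrow> c (x, y) = s x y"
  shows "tree_map k G (zip_map c)"
  unfolding tree_map_def
proof (intro conjI ballI impI)
  fix v assume "v \<in> verts G"
  then consider u where "u \<in> V" "v = Inl u"
    | x y i where "(x, y) \<in> edge_pairs" "i \<le> s x y" "v = Inr (x, y, i)"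
    by (auto simp: verts_eq)
  then show "\<exists>h m. zip_map c v = Inl (h, m) \<and> h \<le> k \<and> m < 2 ^ (k - h)"
  proof cases
    case 1
    then show ?thesis using idx_less by (simp add: zip_map_def anc_def)
  next
    case 2
    then show ?thesis using walk_bounds[of x y i] full by (auto simp: zip_map_def)
  qed
next
  fix v w assume "{v, w} \<in> blacks G \<union> reds G"
  then obtain x y i where e: "(x, y) \<in> edge_pairs" "i \<le> s x y" and
    vw: "{v, w} = {sv x y i, sv x y (Suc i)}"
    unfolding edge_iff by blast
  have "tree_near (zip_map c (sv x y i)) (zip_map c (sv x y (Suc i)))"
    using zip_map_sv[OF e(1), of i c] zip_map_sv[OF e(1), of "Suc i" c] e full[OF e(1)] walk_near[OF e]
    by (auto simp: not_less_eq_eq)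
  then show "tree_near (zip_map c v) (zip_map c w)"
    using vw tree_near_sym by (auto simp: doubleton_eq_iff)
qed

text \<open>Induction on the number of unfolded subdivision vertices. Each step folds the next
  vertex of one path; once all paths are folded, the map is a \<open>tree_map\<close> and the tree
  is collapsed.\<close>

lemma collapsible_zip_map: "zip_state c e0 \<Longrightarrow> collapsible 4 G (zip_map c)"
proof (induction "\<Sum>(x, y)\<in>edge_pairs. s x y - c (x, y)" arbitrary: c e0 rule: less_induct)
  case less
  have deg: "card (quot_red_nbrs G (zip_map c) p) \<le> 4" if "p \<in> zip_map c ` verts G" for p
    using card_red_nbrs_zip[OF less.prems that] .
  have le: "c (x, y) \<le> s x y" if "(x, y) \<in> edge_pairs" for x y
    using less.prems that by (auto simp: zip_state_def)
  show ?case
  proof (cases "\<forall>(x, y)\<in>edge_pairs. c (x, y) = s x y")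
    case True
    then have "tree_map k G (zip_map c)"
      by (intro tree_map_zip_map) auto
    then show ?thesis by (rule collapsible_tree_map[OF finite_verts]) simp
  next
    case False
    \<comment> \<open>The path \<open>e0\<close> is continued if it is unfinished. Otherwise every
      path is folded entirely or not at all, and any unfinished one may be started.\<close>
    obtain x y where e: "(x, y) \<in> edge_pairs" "c (x, y) \<noteq> s x y"
      and others: "\<And>x' y'. (x', y') \<in> edge_pairs \<Longrightarrow> (x', y') \<noteq> (x, y) \<Longrightarrow>
        c (x', y') = 0 \<or> c (x', y') = s x' y'"
    proof (cases "e0 \<in> edge_pairs \<and> c e0 \<noteq> s (fst e0) (snd e0)")
      case True
      then show ?thesis
        using that[of "fst e0" "snd e0"] less.prems by (force simp: zip_state_def)
    next
      case no: False
      obtain x y where xy: "(x, y) \<in> edge_pairs" "c (x, y) \<noteq> s x y" using False by blast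
      show ?thesis
      proof (rule that[OF xy])
        fix x' y' assume "(x', y') \<in> edge_pairs"
        then show "c (x', y') = 0 \<or> c (x', y') = s x' y'"
          using no less.prems by (cases "(x', y') = e0") (auto simp: zip_state_def)
      qed
    qed
    let ?c = "c((x, y) := Suc (c (x, y)))"
    have lt: "c (x, y) < s x y" using e le by (meson le_neq_implies_less)
    have "zip_state ?c (x, y)"
      using le others lt by (auto simp: zip_state_def)
    moreover have "(\<Sum>(x, y)\<in>edge_pairs. s x y - ?c (x, y)) < (\<Sum>(x, y)\<in>edge_pairs. s x y - c (x, y))"
    proof (rule sum_strict_mono_ex1[OF finite_edge_pairs])
      show "\<forall>p\<in>edge_pairs. (case p of (x', y') \<Rightarrow> s x' y' - ?c (x', y'))
          \<le> (case p of (x', y') \<Rightarrow> s x' y' - c (x', y'))"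
        by auto
      show "\<exists>p\<in>edge_pairs. (case p of (x', y') \<Rightarrow> s x' y' - ?c (x', y'))
          < (case p of (x', y') \<Rightarrow> s x' y' - c (x', y'))"
        using e lt by (intro bexI[of _ "(x, y)"]) auto
    qed
    ultimately have "collapsible 4 G (zip_map ?c)"
      by (rule less.hyps[rotated])
    then show ?thesis
      unfolding zip_map_step using deg by (rule step[rotated])
  qed
qed

lemma tww_le_4: "tww G \<le> 4"
proof (rule tww_le_if_collapsible[OF wf_G])
  have "inj_on (zip_map (\<lambda>_. 0)) (Inl ` V)"
    using idx_inj by (simp add: inj_on_def zip_map_def anc_def)
  \<comment> \<open>Subdivision positions start at 1, so the zero counter folds nothing.\<close>
  moreover have "zip_map (\<lambda>_. 0) v = Inr (projr v)" if "v \<in> verts G - Inl ` V" for v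
    using that by (auto simp: verts_eq zip_map_def)
  moreover have "zip_map (\<lambda>_. 0) v = Inl (anc (projl v) 0)" if "v \<in> Inl ` V" for v
    using that by (auto simp: zip_map_def)
  ultimately show "inj_on (zip_map (\<lambda>_. 0)) (verts G)"
    by (intro inj_onI) (metis DiffI Inl_Inr_False inj_onD zip_map_eq_Inr prod_cases3)
  show "collapsible 4 G (zip_map (\<lambda>_. 0))"
    \<comment> \<open>With all counters 0 any pair can serve as the current path.\<close>
    by (rule collapsible_zip_map[of _ undefined]) (auto simp: zip_state_def)
qed

end

section \<open>Choice of the tree height\<close>

theorem theorem3p1:
  fixes VH :: "('a::linorder) set" and EH :: "'a set set" and n :: nat
    and s :: "'a \<Rightarrow> 'a \<Rightarrow> nat" and G :: "('a + ('a \<times> 'a \<times> nat)) trigraph"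
  assumes "simple_graph VH EH"
    and "n = card VH"
    and "\<And>x y. x < y \<Longrightarrow> {x, y} \<in> EH \<Longrightarrow>
           int (s x y) \<ge> 2 * \<lceil>log 2 (real n)\<rceil> - 1"
    and "verts G = subdiv_verts VH EH s"
    and "blacks G \<union> reds G = subdiv_edges EH s"
    and "blacks G \<inter> reds G = {}"
    and "\<And>x. x \<in> verts G \<Longrightarrow> red_degree G x \<le> 4"
    and "\<And>x. x \<in> verts G \<Longrightarrow> red_degree G x = 4 \<Longrightarrow> \<not> (\<exists>e \<in> blacks G. x \<in> e)"
  shows "tww G \<le> 4"
proof -
  have fin: "finite VH" using assms(1) by (simp add: simple_graph_def)
  then obtain idx where idx: "bij_betw idx VH {0..<n}"
    using ex_bij_betw_finite_nat assms(2) by blast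
  \<comment> \<open>The maximum keeps the height positive when \<open>n = 1\<close>, where the
    logarithm is 0.\<close>
  define k where "k = max 1 (nat \<lceil>log 2 (real n)\<rceil>)"
  have n_le: "n \<le> 2 ^ k"
  proof (cases "n = 0")
    case False
    have "log 2 (real n) \<le> real k" unfolding k_def by linarith
    then have "real n \<le> 2 powr real k" using False by (simp add: log_le_iff)
    then show ?thesis by (simp add: powr_realpow)
  qed simp
  \<comment> \<open>The length hypothesis speaks of the logarithm itself. It is applied only to
    edges of H, and an edge forces \<open>n\<close> to be at least 2, so that the maximum equals the
    rounded logarithm.\<close>
  have k_eq: "k = nat \<lceil>log 2 (real n)\<rceil>" if "x < y" "{x, y} \<in> EH" for x y
  proof -
    have "{x, y} \<in> {{x, y} | x y. x \<in> VH \<and> y \<in> VH \<and> x \<noteq> y}"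
      using assms(1) that unfolding simple_graph_def by blast
    then have "{x, y} \<subseteq> VH" by (auto simp: doubleton_eq_iff)
    then have "2 \<le> n" using card_mono[OF fin, of "{x, y}"] that assms(2) by simp
    then have "1 \<le> log 2 (real n)" by (simp add: le_log_iff)
    then show ?thesis unfolding k_def by linarith
  qed
  have "subdivided_trigraph VH EH s G k idx"
  proof
    show "idx v < 2 ^ k" if "v \<in> VH" for v
      using bij_betwE[OF idx] that n_le by fastforce
    show "2 * k \<le> s x y + 1" if "x < y" "{x, y} \<in> EH" for x y
      using assms(3)[OF that] k_eq[OF that] by linarith
  qed (use assms idx in \<open>auto simp: k_def bij_betw_def\<close>)
  then show ?thesis by (rule subdivided_trigraph.tww_le_4)
qed

end
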